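(* Let $A:\hat\Sigma_{\mathbf M}\to\mathbb R$ be Lipschitz continuous and, for $\beta>0$, let $\lambda_\beta\in\mathbb R$ be the effective constant for $\beta A$. Then the limit $$c_A:=\lim_{\beta\to\infty}\frac{\lambda_\beta}{\beta}$$ exists (as a real number).
   Context: Let $\mathbf M:\{1,\dots,r\}\times\{1,\dots,r\}\to\{0,1\}$ be an irreducible symmetric transition matrix. Let $\Sigma_{\mathbf M}=\{(x_0,x_1,\dots)\in\{1,\dots,r\}^{\mathbb Z_+}:\mathbf M(x_j,x_{j+1})=1\ \forall j\}$, with left shift $\sigma(x_0,x_1,x_2,\dots)=(x_1,x_2,\dots)$, and let $\Sigma^*_{\mathbf M}$ be the dual subshift of sequences $(\dots,x_1,x_0)$ with $\mathbf M(x_{j+1},x_j)=1$ for all $j$. As $\mathbf M$ is symmetric, $\mathbf x=(x_0,x_1,\dots)\mapsto\mathbf x^*=(\dots,x_1,x_0)$ is a bijection $\Sigma_{\mathbf M}\to\Sigma^*_{\mathbf M}$, by which the two spaces, and functions on them, are identified (points $\mathbf y^*$ are written simply $\mathbf y$). Fix $\Lambda\in(0,1)$; for $\mathbf x\neq\mathbf y$ put $d(\mathbf x,\mathbf y)=\Lambda^k$ with $k=\min\{j:x_j\neq y_j\}$ (and $d(\mathbf x,\mathbf x)=0$). $\mathcal H$ is the space of Lipschitz continuous real functions on $\Sigma_{\mathbf M}\simeq\Sigma^*_{\mathbf M}$. Let $\hat\Sigma_{\mathbf M}=\{(\mathbf y,\mathbf x)\in\Sigma^*_{\mathbf M}\times\Sigma_{\mathbf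 M}:\mathbf M(y_0,x_0)=1\}$ with the product (max) metric. In every expression where $\mathbf y$ is fixed and $\mathbf x$ ranges over all of $\Sigma_{\mathbf M}$, $A(\mathbf y,\mathbf x)$ means $A(\mathbf y,\mathbf x)\mathbf M(y_0,x_0)$, i.e. $A$ is extended by $0$. Let $\mathcal M_\sigma$ be the set of $\sigma$-invariant Borel probability measures on $\Sigma_{\mathbf M}$ and $h_\mu(\sigma)$ the Kolmogorov–Sinai entropy. For $\beta>0$ and $\phi\in\mathcal H$ put $$\mathcal G_\beta(\phi)(\mathbf y)=\sup_{\mu\in\mathcal M_\sigma}\Big[\int_{\Sigma_{\mathbf M}}\big(\beta A(\mathbf y,\mathbf x)+\phi(\mathbf x)\big)\,d\mu(\mathbf x)+h_\mu(\sigma)\Big].$$ There is a function $\phi_\beta\in\mathcal H$, unique up to an additive constant, and a unique $\lambda_\beta\in\mathbb R$ with $\mathcal G_\beta(\phi_\beta)=\phi_\beta+\lambda_\beta$; $\phi_\beta$ is the effective potential and $\lambda_\beta$ the effective constant for $\beta A$. *)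

theory Defs
  imports "HOL-Probability.Probability_Measure"
begin

section \<open>Symmetric irreducible transition matrices and their subshifts\<close>

primrec matrix_power :: "nat \<Rightarrow> (nat \<Rightarrow> nat \<Rightarrow> nat) \<Rightarrow> nat \<Rightarrow> nat \<Rightarrow> nat \<Rightarrow> nat" where
  "matrix_power r M 0 i j = (if i = j then 1 else 0)"
| "matrix_power r M (Suc n) i j = (\<Sum>k\<in>{1..r}. matrix_power r M n i k * M k j)"

definition transition_matrix :: "nat \<Rightarrow> (nat \<Rightarrow> nat \<Rightarrow> nat) \<Rightarrow> bool" where
  "transition_matrix r M \<longleftrightarrow> r \<ge> 1 \<and> (\<forall>i\<in>{1..r}. \<forall>j\<in>{1..r}. M i j \<in> {0, 1})"

definition symmetric_matrix :: "nat \<Rightarrow> (nat \<Rightarrow> nat \<Rightarrow> nat) \<Rightarrow> bool" where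
  "symmetric_matrix r M \<longleftrightarrow> (\<forall>i\<in>{1..r}. \<forall>j\<in>{1..r}. M i j = M j i)"

definition irreducible_matrix :: "nat \<Rightarrow> (nat \<Rightarrow> nat \<Rightarrow> nat) \<Rightarrow> bool" where
  "irreducible_matrix r M \<longleftrightarrow>
     (\<forall>i\<in>{1..r}. \<forall>j\<in>{1..r}. \<exists>n\<ge>1. matrix_power r M n i j > 0)"

definition subshift :: "nat \<Rightarrow> (nat \<Rightarrow> nat \<Rightarrow> nat) \<Rightarrow> (nat \<Rightarrow> nat) set" where
  "subshift r M = {x. \<forall>j. x j \<in> {1..r} \<and> M (x j) (x (Suc j)) = 1}"

text \<open>A left-infinite sequence \<open>(\<dots>, x\<^sub>1, x\<^sub>0)\<close> is represented by the function \<open>j \<mapsto> x\<^sub>j\<close>, so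
  that the identification of the subshift with its dual is the identity on functions.\<close>

definition dual_subshift :: "nat \<Rightarrow> (nat \<Rightarrow> nat \<Rightarrow> nat) \<Rightarrow> (nat \<Rightarrow> nat) set" where
  "dual_subshift r M = {x. \<forall>j. x j \<in> {1..r} \<and> M (x (Suc j)) (x j) = 1}"

lemma dual_subshift_eq_subshift:
  assumes "symmetric_matrix r M"
  shows "dual_subshift r M = subshift r M"
proof -
  have "M (x (Suc j)) (x j) = M (x j) (x (Suc j))" if "\<forall>j. x j \<in> {1..r}" for x j
    using assms that unfolding symmetric_matrix_def by blast
  then show ?thesis
    unfolding dual_subshift_def subshift_def all_conj_distrib by (intro Collect_cong) metis
qed

definition shift :: "(nat \<Rightarrow> nat) \<Rightarrow> (nat \<Rightarrow> nat)" where
  "shift x = (\<lambda>j. x (Suc j))"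

definition natural_extension ::
    "nat \<Rightarrow> (nat \<Rightarrow> nat \<Rightarrow> nat) \<Rightarrow> ((nat \<Rightarrow> nat) \<times> (nat \<Rightarrow> nat)) set" where
  "natural_extension r M =
     {(y, x). y \<in> dual_subshift r M \<and> x \<in> subshift r M \<and> M (y 0) (x 0) = 1}"

definition seq_dist :: "real \<Rightarrow> (nat \<Rightarrow> nat) \<Rightarrow> (nat \<Rightarrow> nat) \<Rightarrow> real" where
  "seq_dist \<Lambda> x y = (if x = y then 0 else \<Lambda> ^ (LEAST j. x j \<noteq> y j))"

definition pair_dist ::
    "real \<Rightarrow> (nat \<Rightarrow> nat) \<times> (nat \<Rightarrow> nat) \<Rightarrow> (nat \<Rightarrow> nat) \<times> (nat \<Rightarrow> nat) \<Rightarrow> real" where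
  "pair_dist \<Lambda> p q = max (seq_dist \<Lambda> (fst p) (fst q)) (seq_dist \<Lambda> (snd p) (snd q))"

definition Lipschitz_wrt :: "('a \<Rightarrow> 'a \<Rightarrow> real) \<Rightarrow> 'a set \<Rightarrow> ('a \<Rightarrow> real) \<Rightarrow> bool" where
  "Lipschitz_wrt d X f \<longleftrightarrow> (\<exists>L. \<forall>x\<in>X. \<forall>y\<in>X. \<bar>f x - f y\<bar> \<le> L * d x y)"

section \<open>Invariant measures and Kolmogorov--Sinai entropy\<close>

definition finite_measurable_partitions :: "'a measure \<Rightarrow> 'a set set set" where
  "finite_measurable_partitions \<mu> =
     {P. finite P \<and> partition_on (space \<mu>) P \<and> P \<subseteq> sets \<mu>}"

definition preimage_partition :: "'a measure \<Rightarrow> ('a \<Rightarrow> 'a) \<Rightarrow> 'a set set \<Rightarrow> 'a set set" where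
  "preimage_partition \<mu> T P = (\<lambda>C. T -` C \<inter> space \<mu>) ` P - {{}}"

definition dynamical_refinement ::
    "'a measure \<Rightarrow> ('a \<Rightarrow> 'a) \<Rightarrow> 'a set set \<Rightarrow> nat \<Rightarrow> 'a set set" where
  "dynamical_refinement \<mu> T P n =
     common_refinement ((\<lambda>k. preimage_partition \<mu> (T ^^ k) P) ` {..<n})"

text \<open>The convention \<open>0 * ln 0 = 0\<close> holds because of the factor \<open>0\<close>.\<close>

definition partition_entropy :: "'a measure \<Rightarrow> 'a set set \<Rightarrow> real" where
  "partition_entropy \<mu> P = - (\<Sum>C\<in>P. measure \<mu> C * ln (measure \<mu> C))"

definition entropy_wrt_partition :: "'a measure \<Rightarrow> ('a \<Rightarrow> 'a) \<Rightarrow> 'a set set \<Rightarrow> ereal" where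
  "entropy_wrt_partition \<mu> T P =
     lim (\<lambda>n. ereal (partition_entropy \<mu> (dynamical_refinement \<mu> T P n) / real n))"

text \<open>Entropy takes values in the extended reals, so that the suprema below are genuine
  suprema whether or not they are known to be finite.\<close>

definition KS_entropy :: "'a measure \<Rightarrow> ('a \<Rightarrow> 'a) \<Rightarrow> ereal" where
  "KS_entropy \<mu> T = (SUP P\<in>finite_measurable_partitions \<mu>. entropy_wrt_partition \<mu> T P)"

text \<open>For \<open>0 < \<Lambda> < 1\<close> the metric \<open>seq_dist \<Lambda>\<close> induces the topology inherited from the
  product topology on \<^typ>\<open>nat \<Rightarrow> nat\<close>, so \<^term>\<open>restrict_space borel (subshift r M)\<close> is the Borel
  \<open>\<sigma>\<close>-algebra of the subshift.\<close>

definition invariant_measures ::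
    "nat \<Rightarrow> (nat \<Rightarrow> nat \<Rightarrow> nat) \<Rightarrow> (nat \<Rightarrow> nat) measure set" where
  "invariant_measures r M =
     {\<mu>. sets \<mu> = sets (restrict_space borel (subshift r M)) \<and> prob_space \<mu> \<and>
          shift \<in> measurable \<mu> \<mu> \<and> distr \<mu> \<mu> shift = \<mu>}"

section \<open>The effective constant\<close>

text \<open>The factor \<open>M (y 0) (x 0)\<close> extends \<open>A (y, \<cdot>)\<close> by zero to the whole subshift.\<close>

definition effective_operator ::
    "nat \<Rightarrow> (nat \<Rightarrow> nat \<Rightarrow> nat) \<Rightarrow> ((nat \<Rightarrow> nat) \<times> (nat \<Rightarrow> nat) \<Rightarrow> real) \<Rightarrow> real \<Rightarrow>
     ((nat \<Rightarrow> nat) \<Rightarrow> real) \<Rightarrow> (nat \<Rightarrow> nat) \<Rightarrow> ereal" where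
  "effective_operator r M A \<beta> \<phi> y =
     (SUP \<mu>\<in>invariant_measures r M.
        ereal (\<integral>x. \<beta> * (A (y, x) * real (M (y 0) (x 0))) + \<phi> x \<partial>\<mu>) + KS_entropy \<mu> shift)"

definition is_effective_constant ::
    "nat \<Rightarrow> (nat \<Rightarrow> nat \<Rightarrow> nat) \<Rightarrow> real \<Rightarrow> ((nat \<Rightarrow> nat) \<times> (nat \<Rightarrow> nat) \<Rightarrow> real) \<Rightarrow> real \<Rightarrow>
     real \<Rightarrow> bool" where
  "is_effective_constant r M \<Lambda> A \<beta> l \<longleftrightarrow>
     (\<exists>\<phi>. Lipschitz_wrt (seq_dist \<Lambda>) (subshift r M) \<phi> \<and>
          (\<forall>y\<in>dual_subshift r M. effective_operator r M A \<beta> \<phi> y = ereal (\<phi> y + l)))"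

end

theory Submission
  imports Defs
begin

text \<open>
  The effective constant is a nonlinear eigenvalue: \<open>\<G>\<^sub>\<beta> \<phi> = \<phi> + \<lambda>\<^sub>\<beta>\<close>.  The operator is
  a supremum, over invariant measures \<open>\<mu>\<close>, of expressions that are affine in \<open>(\<beta>, \<phi>)\<close>.  So
  \<open>\<G>\<^sub>\<beta> \<phi>\<close> is jointly convex in \<open>(\<beta>, \<phi>)\<close>; it is also monotone in \<open>\<phi>\<close> and commutes with the
  addition of constants, and it changes by at most \<open>B \<bar>\<beta> - \<beta>'\<bar>\<close> with \<open>\<beta>\<close> when \<open>\<bar>A\<bar> \<le> B\<close>.  All
  these properties pass to the eigenvalue by a comparison argument: if \<open>\<G>\<^sub>\<beta> \<psi> \<le> \<psi> + m\<close> for some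
  bounded \<open>\<psi>\<close>, then with \<open>c = sup (\<phi> - \<psi>)\<close> we get
  \<open>\<phi> + \<lambda>\<^sub>\<beta> = \<G>\<^sub>\<beta> \<phi> \<le> \<G>\<^sub>\<beta> \<psi> + c \<le> \<psi> + m + c\<close>, and taking the supremum of \<open>\<phi> - \<psi>\<close> yields
  \<open>\<lambda>\<^sub>\<beta> \<le> m\<close>.  Using a convex combination of two effective potentials as \<open>\<psi>\<close> shows that
  \<open>\<beta> \<mapsto> \<lambda>\<^sub>\<beta>\<close> is convex, and using the potential of another parameter shows that it is
  \<open>B\<close>-Lipschitz (both are contained in \<open>effective_constant_le_mix\<close>).

  A convex function of at most linear growth has a limiting slope: the difference quotients based
  at \<open>1\<close> are nondecreasing and bounded above by \<open>B\<close>, and \<open>\<lambda>\<^sub>\<beta> / \<beta>\<close> is asymptotic to them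
  (\<open>convex_linear_growth_slope_limit\<close>).

  The entropy enters only as a common term depending on \<open>\<mu>\<close> alone; that it is not \<open>\<infinity>\<close> is
  read off from the finiteness of \<open>\<G>\<^sub>\<beta> \<phi>\<close>.
\<close>

section \<open>Lipschitz functions on the subshift\<close>

lemma seq_dist_le_power:
  assumes "0 < \<Lambda>" "\<Lambda> < 1" "\<forall>i<n. z i = x i"
  shows "seq_dist \<Lambda> z x \<le> \<Lambda> ^ n"
proof (cases "z = x")
  case True
  then show ?thesis using assms by (simp add: seq_dist_def)
next
  case False
  then obtain k where "z k \<noteq> x k" by auto
  then have "z (LEAST j. z j \<noteq> x j) \<noteq> x (LEAST j. z j \<noteq> x j)"
    by (rule LeastI)
  then have "n \<le> (LEAST j. z j \<noteq> x j)"
    using assms(3) not_le by blast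
  then show ?thesis
    using False assms by (simp add: seq_dist_def power_decreasing)
qed

lemma seq_dist_nonneg: "0 < \<Lambda> \<Longrightarrow> 0 \<le> seq_dist \<Lambda> z x"
  by (simp add: seq_dist_def)

lemma Lipschitz_wrt_bounded:
  assumes "Lipschitz_wrt d X f" "\<And>x y. 0 \<le> d x y" "\<And>x y. d x y \<le> 1"
  shows "\<exists>B. \<forall>x\<in>X. \<bar>f x\<bar> \<le> B"
proof (cases "X = {}")
  case False
  then obtain p where p: "p \<in> X" by auto
  obtain L where L: "\<And>x y. x \<in> X \<Longrightarrow> y \<in> X \<Longrightarrow> \<bar>f x - f y\<bar> \<le> L * d x y"
    using assms(1) unfolding Lipschitz_wrt_def by blast
  have "\<bar>f x\<bar> \<le> \<bar>L\<bar> + \<bar>f p\<bar>" if "x \<in> X" for x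
  proof -
    have "L * d x p \<le> \<bar>L\<bar> * d x p" by (intro mult_right_mono assms) simp
    also have "\<dots> \<le> \<bar>L\<bar> * 1" by (intro mult_left_mono assms) simp
    finally show ?thesis using L[OF that p] by linarith
  qed
  then show ?thesis by blast
qed simp

text \<open>The cylinders around \<open>x\<close> are product-open because single symbols are open; this links the
  metric of the symbolic space with the topology that underlies the Borel sets.\<close>

lemma continuous_on_if_cylinder_continuous:
  fixes f :: "(nat \<Rightarrow> nat) \<Rightarrow> real"
  assumes "\<And>x e. x \<in> X \<Longrightarrow> e > 0 \<Longrightarrow> \<exists>n. \<forall>z\<in>X. (\<forall>i<n. z i = x i) \<longrightarrow> \<bar>f z - f x\<bar> < e"
  shows "continuous_on X f"
  unfolding continuous_on_def
proof (intro ballI tendstoI)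
  fix x and e :: real
  assume "x \<in> X" "e > 0"
  then obtain n where n: "\<forall>z\<in>X. (\<forall>i<n. z i = x i) \<longrightarrow> \<bar>f z - f x\<bar> < e"
    using assms by blast
  have "open (\<Inter>i<n. (\<lambda>z::nat\<Rightarrow>nat. z i) -` {x i})"
    by (intro open_INT ballI open_vimage open_discrete continuous_on_product_coordinates) simp
  then show "\<forall>\<^sub>F z in at x within X. dist (f z) (f x) < e"
    unfolding eventually_at_topological
    by (rule_tac x = "\<Inter>i<n. (\<lambda>z::nat\<Rightarrow>nat. z i) -` {x i}" in exI)
       (use n in \<open>auto simp: dist_real_def\<close>)
qed

lemma scaled_power_small:
  assumes "0 < \<Lambda>" "\<Lambda> < 1" "(e::real) > 0"
  shows "\<exists>n>0. L * \<Lambda> ^ n < e"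
proof -
  have "(\<lambda>n. L * \<Lambda> ^ n) \<longlonglongrightarrow> L * 0"
    using assms by (intro tendsto_intros LIMSEQ_realpow_zero) auto
  then have "\<forall>\<^sub>F n in sequentially. L * \<Lambda> ^ n < e"
    using assms(3) by (intro order_tendstoD) auto
  then have "\<forall>\<^sub>F n in sequentially. 0 < n \<and> L * \<Lambda> ^ n < e"
    by (intro eventually_conj eventually_gt_at_top)
  then show ?thesis
    by (auto simp: eventually_sequentially)
qed

lemma Lipschitz_wrt_seq_dist_continuous_on:
  assumes "0 < \<Lambda>" "\<Lambda> < 1" "Lipschitz_wrt (seq_dist \<Lambda>) X f"
  shows "continuous_on X f"
proof (rule continuous_on_if_cylinder_continuous)
  fix x and e :: real
  assume x: "x \<in> X" and "e > 0"
  obtain L where L: "\<And>x y. x \<in> X \<Longrightarrow> y \<in> X \<Longrightarrow> \<bar>f x - f y\<bar> \<le> L * seq_dist \<Lambda> x y"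
    using assms(3) unfolding Lipschitz_wrt_def by blast
  obtain n where n: "\<bar>L\<bar> * \<Lambda> ^ n < e"
    using scaled_power_small[OF assms(1,2) \<open>e > 0\<close>] by blast
  have "\<bar>f z - f x\<bar> < e" if "z \<in> X" "\<forall>i<n. z i = x i" for z
  proof -
    have "\<bar>f z - f x\<bar> \<le> L * seq_dist \<Lambda> z x" using L that x by blast
    also have "\<dots> \<le> \<bar>L\<bar> * seq_dist \<Lambda> z x"
      by (intro mult_right_mono seq_dist_nonneg assms) simp
    also have "\<dots> \<le> \<bar>L\<bar> * \<Lambda> ^ n"
      by (intro mult_left_mono seq_dist_le_power assms that) simp
    finally show ?thesis using n by linarith
  qed
  then show "\<exists>n. \<forall>z\<in>X. (\<forall>i<n. z i = x i) \<longrightarrow> \<bar>f z - f x\<bar> < e" by blast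
qed

text \<open>Extending \<open>A (y, \<cdot>)\<close> by zero keeps it continuous, because whether \<open>x\<close> may follow \<open>y\<close>
  depends on the symbol \<open>x\<^sub>0\<close> only.\<close>

lemma zero_extension_continuous_on:
  assumes "0 < \<Lambda>" "\<Lambda> < 1" "transition_matrix r M" "y \<in> dual_subshift r M"
    and "Lipschitz_wrt (pair_dist \<Lambda>) (natural_extension r M) A"
  shows "continuous_on (subshift r M) (\<lambda>x. A (y, x) * real (M (y 0) (x 0)))"
proof (rule continuous_on_if_cylinder_continuous)
  fix x and e :: real
  assume x: "x \<in> subshift r M" and "e > 0"
  obtain L where L: "\<And>p q. p \<in> natural_extension r M \<Longrightarrow> q \<in> natural_extension r M \<Longrightarrow>
      \<bar>A p - A q\<bar> \<le> L * pair_dist \<Lambda> p q"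
    using assms(5) unfolding Lipschitz_wrt_def by blast
  obtain n where n: "n > 0" "\<bar>L\<bar> * \<Lambda> ^ n < e"
    using scaled_power_small[OF assms(1,2) \<open>e > 0\<close>] by blast
  have "\<bar>A (y, z) * real (M (y 0) (z 0)) - A (y, x) * real (M (y 0) (x 0))\<bar> < e"
    if z: "z \<in> subshift r M" "\<forall>i<n. z i = x i" for z
  proof -
    \<comment> \<open>\<open>n > 0\<close> makes the cylinder fix the symbol that decides about the extension by zero.\<close>
    have z0: "z 0 = x 0" using z n by blast
    have "y 0 \<in> {1..r}" "x 0 \<in> {1..r}"
      using assms(4) x unfolding dual_subshift_def subshift_def by blast+
    then have "M (y 0) (x 0) \<in> {0, 1}"
      using assms(3) unfolding transition_matrix_def by blast
    then consider "M (y 0) (x 0) = 0" | "M (y 0) (x 0) = 1" by auto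
    then show ?thesis
    proof cases
      case 1
      then show ?thesis using z0 \<open>e > 0\<close> by simp
    next
      case 2
      have dist: "pair_dist \<Lambda> (y, z) (y, x) = seq_dist \<Lambda> z x"
        using seq_dist_nonneg[OF assms(1), of z x] by (simp add: pair_dist_def seq_dist_def)
      have "(y, z) \<in> natural_extension r M" "(y, x) \<in> natural_extension r M"
        using 2 z0 z x assms(4) by (simp_all add: natural_extension_def)
      then have "\<bar>A (y, z) - A (y, x)\<bar> \<le> L * seq_dist \<Lambda> z x"
        using L dist by metis
      also have "\<dots> \<le> \<bar>L\<bar> * seq_dist \<Lambda> z x"
        by (intro mult_right_mono seq_dist_nonneg assms) simp
      also have "\<dots> \<le> \<bar>L\<bar> * \<Lambda> ^ n"
        by (intro mult_left_mono seq_dist_le_power assms z) simp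
      finally show ?thesis using n 2 z0 by simp
    qed
  qed
  then show "\<exists>n. \<forall>z\<in>subshift r M. (\<forall>i<n. z i = x i) \<longrightarrow>
      \<bar>A (y, z) * real (M (y 0) (z 0)) - A (y, x) * real (M (y 0) (x 0))\<bar> < e" by blast
qed

lemma zero_extension_bounded:
  assumes "0 < \<Lambda>" "\<Lambda> < 1" "transition_matrix r M"
    and "Lipschitz_wrt (pair_dist \<Lambda>) (natural_extension r M) A"
  shows "\<exists>B. \<forall>y\<in>dual_subshift r M. \<forall>x\<in>subshift r M.
           \<bar>A (y, x) * real (M (y 0) (x 0))\<bar> \<le> B"
proof -
  have le1: "seq_dist \<Lambda> x y \<le> 1" for x y
    using seq_dist_le_power[OF assms(1,2), of 0] by simp
  have "\<exists>B. \<forall>p\<in>natural_extension r M. \<bar>A p\<bar> \<le> B"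
    using assms(4) by (rule Lipschitz_wrt_bounded)
      (use assms(1) in \<open>auto simp: pair_dist_def le1 le_max_iff_disj seq_dist_nonneg\<close>)
  then obtain B where B: "\<And>p. p \<in> natural_extension r M \<Longrightarrow> \<bar>A p\<bar> \<le> B" by blast
  have "\<bar>A (y, x) * real (M (y 0) (x 0))\<bar> \<le> \<bar>B\<bar>"
    if "y \<in> dual_subshift r M" "x \<in> subshift r M" for x y
  proof -
    have "y 0 \<in> {1..r}" "x 0 \<in> {1..r}"
      using that unfolding dual_subshift_def subshift_def by blast+
    then have "M (y 0) (x 0) \<in> {0, 1}"
      using assms(3) unfolding transition_matrix_def by blast
    then consider "M (y 0) (x 0) = 0" | "M (y 0) (x 0) = 1" by auto
    then show ?thesis
    proof cases
      case 2
      then show ?thesis using B[of "(y, x)"] that by (simp add: natural_extension_def)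
    qed simp
  qed
  then show ?thesis by blast
qed

lemma invariant_measures_integrable:
  fixes f :: "(nat \<Rightarrow> nat) \<Rightarrow> real"
  assumes "\<mu> \<in> invariant_measures r M" "continuous_on (subshift r M) f"
    and "\<And>x. x \<in> subshift r M \<Longrightarrow> \<bar>f x\<bar> \<le> B"
  shows "integrable \<mu> f"
proof -
  have sets: "sets \<mu> = sets (restrict_space borel (subshift r M))" and "prob_space \<mu>"
    using assms(1) by (auto simp: invariant_measures_def)
  interpret prob_space \<mu> by fact
  have space: "space \<mu> = subshift r M"
    using sets_eq_imp_space_eq[OF sets] by (simp add: space_restrict_space)
  show ?thesis
  proof (rule integrable_const_bound[where B = B])
    show "AE x in \<mu>. norm (f x) \<le> B"
      by (intro AE_I2) (use assms(3) space in auto)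
    show "f \<in> borel_measurable \<mu>"
      using borel_measurable_continuous_on_restrict[OF assms(2)] sets
      by (simp cong: measurable_cong_sets)
  qed
qed

section \<open>Irreducible subshifts are nonempty\<close>

text \<open>Irreducibility gives every symbol a predecessor, hence by symmetry a successor; following
  successors produces a point.\<close>

lemma subshift_nonempty:
  assumes "transition_matrix r M" "symmetric_matrix r M" "irreducible_matrix r M"
  shows "subshift r M \<noteq> {}"
proof -
  have "\<exists>k. k \<in> {1..r} \<and> M j k = 1" if j: "j \<in> {1..r}" for j
  proof -
    obtain n where n: "n \<ge> 1" "matrix_power r M n j j > 0"
      using assms(3) j unfolding irreducible_matrix_def by blast
    then obtain m where "n = Suc m" by (cases n) auto
    then have "(\<Sum>k\<in>{1..r}. matrix_power r M m j k * M k j) \<noteq> 0"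
      using n(2) by (simp del: sum_eq_0_iff)
    then obtain k where k: "k \<in> {1..r}" "matrix_power r M m j k * M k j \<noteq> 0"
      by (meson sum.neutral)
    then have "M k j = 1"
      using assms(1) j unfolding transition_matrix_def by fastforce
    moreover have "M j k = M k j"
      using assms(2) j k unfolding symmetric_matrix_def by blast
    ultimately show ?thesis using k by auto
  qed
  then obtain g where g: "\<And>j. j \<in> {1..r} \<Longrightarrow> g j \<in> {1..r} \<and> M j (g j) = 1"
    by metis
  have "1 \<in> {1..r}" using assms(1) by (simp add: transition_matrix_def)
  then have range: "(g ^^ j) 1 \<in> {1..r}" for j
    by (induction j) (use g in auto)
  have "(\<lambda>j. (g ^^ j) 1) \<in> subshift r M"
    unfolding subshift_def using range g[OF range] by simp
  then show ?thesis by blast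
qed

section \<open>Comparison of effective constants\<close>

text \<open>One inequality carries both properties of \<open>\<beta> \<mapsto> \<lambda>\<^sub>\<beta>\<close>: \<open>\<beta> = t \<beta>\<^sub>1 + (1 - t) \<beta>\<^sub>2\<close> gives convexity,
  and \<open>t = 1\<close> gives the Lipschitz bound.  The test function is the convex combination \<open>\<psi>\<close> of the
  two effective potentials.  For each single measure the functional at \<open>(\<beta>, \<phi>)\<close> is bounded by the
  corresponding convex combination, plus \<open>sup (\<phi> - \<psi>)\<close> and the error from the change of parameter;
  the entropy splits as \<open>h = t h + (1 - t) h\<close>.\<close>

lemma effective_constant_le_mix:
  assumes M: "transition_matrix r M" "symmetric_matrix r M" "irreducible_matrix r M"
    and \<Lambda>: "0 < \<Lambda>" "\<Lambda> < 1"
    and A: "Lipschitz_wrt (pair_dist \<Lambda>) (natural_extension r M) A"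
    and B: "\<And>y x. y \<in> dual_subshift r M \<Longrightarrow> x \<in> subshift r M \<Longrightarrow>
              \<bar>A (y, x) * real (M (y 0) (x 0))\<bar> \<le> B"
    and l: "is_effective_constant r M \<Lambda> A \<beta> l"
    and l1: "is_effective_constant r M \<Lambda> A \<beta>1 l1"
    and l2: "is_effective_constant r M \<Lambda> A \<beta>2 l2"
    and t: "0 \<le> t" "t \<le> 1"
  shows "l \<le> t * l1 + (1 - t) * l2 + \<bar>\<beta> - (t * \<beta>1 + (1 - t) * \<beta>2)\<bar> * B"
proof -
  let ?X = "subshift r M"
  define E where "E = \<bar>\<beta> - (t * \<beta>1 + (1 - t) * \<beta>2)\<bar> * B"
  have dual: "dual_subshift r M = ?X" by (rule dual_subshift_eq_subshift[OF M(2)])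
  have ne: "?X \<noteq> {}" by (rule subshift_nonempty[OF M])
  obtain \<phi> \<phi>1 \<phi>2 where
    lip: "Lipschitz_wrt (seq_dist \<Lambda>) ?X \<phi>" "Lipschitz_wrt (seq_dist \<Lambda>) ?X \<phi>1"
      "Lipschitz_wrt (seq_dist \<Lambda>) ?X \<phi>2"
    and eig: "\<And>y. y \<in> ?X \<Longrightarrow> effective_operator r M A \<beta> \<phi> y = ereal (\<phi> y + l)"
    and eig1: "\<And>y. y \<in> ?X \<Longrightarrow> effective_operator r M A \<beta>1 \<phi>1 y = ereal (\<phi>1 y + l1)"
    and eig2: "\<And>y. y \<in> ?X \<Longrightarrow> effective_operator r M A \<beta>2 \<phi>2 y = ereal (\<phi>2 y + l2)"
    using l l1 l2 unfolding is_effective_constant_def dual by metis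
  have bdd: "\<exists>C. \<forall>x\<in>?X. \<bar>f x\<bar> \<le> C" if "Lipschitz_wrt (seq_dist \<Lambda>) ?X f" for f
    using that seq_dist_nonneg[OF \<Lambda>(1)] seq_dist_le_power[OF \<Lambda>, of 0]
    by (intro Lipschitz_wrt_bounded) auto
  define \<psi> where "\<psi> x = t * \<phi>1 x + (1 - t) * \<phi>2 x" for x
  define c where "c = (SUP x\<in>?X. \<phi> x - \<psi> x)"
  obtain C C1 C2 where C: "\<And>x. x \<in> ?X \<Longrightarrow> \<bar>\<phi> x\<bar> \<le> C" "\<And>x. x \<in> ?X \<Longrightarrow> \<bar>\<phi>1 x\<bar> \<le> C1"
    "\<And>x. x \<in> ?X \<Longrightarrow> \<bar>\<phi>2 x\<bar> \<le> C2"
    using bdd[OF lip(1)] bdd[OF lip(2)] bdd[OF lip(3)] by blast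
  have "\<phi> x - \<psi> x \<le> C + (t * C1 + (1 - t) * C2)" if x: "x \<in> ?X" for x
  proof -
    have "t * (- C1) + (1 - t) * (- C2) \<le> \<psi> x"
      unfolding \<psi>_def by (intro add_mono mult_left_mono) (use C(2,3)[OF x] t in auto)
    then show ?thesis using C(1)[OF x] by linarith
  qed
  then have "bdd_above ((\<lambda>x. \<phi> x - \<psi> x) ` ?X)" by (intro bdd_aboveI2)
  then have c: "\<phi> x \<le> \<psi> x + c" if "x \<in> ?X" for x
    using cSUP_upper[of x ?X "\<lambda>x. \<phi> x - \<psi> x"] that by (simp add: c_def)
  have bound: "\<phi> y + l \<le> \<psi> y + (t * l1 + (1 - t) * l2) + c + E" if y: "y \<in> ?X" for y
  proof -
    define a where "a x = A (y, x) * real (M (y 0) (x 0))" for x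
    have aB: "\<bar>a x\<bar> \<le> B" if "x \<in> ?X" for x
      using B[of y x] that y by (simp add: a_def dual)
    have conta: "continuous_on ?X a"
      unfolding a_def using zero_extension_continuous_on[OF \<Lambda> M(1) _ A, of y] y dual by simp
    have "ereal (\<integral>x. \<beta> * a x + \<phi> x \<partial>\<mu>) + KS_entropy \<mu> shift
            \<le> ereal (\<psi> y + (t * l1 + (1 - t) * l2) + c + E)"
      if \<mu>: "\<mu> \<in> invariant_measures r M" for \<mu>
    proof -
      have "prob_space \<mu>" and sets: "sets \<mu> = sets (restrict_space borel ?X)"
        using \<mu> by (auto simp: invariant_measures_def)
      interpret prob_space \<mu> by fact
      have space: "space \<mu> = ?X"
        using sets_eq_imp_space_eq[OF sets] by (simp add: space_restrict_space)
      have inta: "integrable \<mu> a"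
        using \<mu> conta aB by (rule invariant_measures_integrable)
      have int: "integrable \<mu> \<phi>" "integrable \<mu> \<phi>1" "integrable \<mu> \<phi>2"
        by (rule invariant_measures_integrable[OF \<mu>
              Lipschitz_wrt_seq_dist_continuous_on[OF \<Lambda>]], rule lip, rule C, assumption)+
      define I1 where "I1 = (\<integral>x. \<beta>1 * a x + \<phi>1 x \<partial>\<mu>)"
      define I2 where "I2 = (\<integral>x. \<beta>2 * a x + \<phi>2 x \<partial>\<mu>)"
      have "(\<integral>x. \<beta> * a x + \<phi> x \<partial>\<mu>)
              \<le> (\<integral>x. t * (\<beta>1 * a x + \<phi>1 x) + (1 - t) * (\<beta>2 * a x + \<phi>2 x) + (c + E) \<partial>\<mu>)"
      proof (rule integral_mono)
        fix x assume "x \<in> space \<mu>"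
        then have x: "x \<in> ?X" by (simp add: space)
        have "(\<beta> - (t * \<beta>1 + (1 - t) * \<beta>2)) * a x
                \<le> \<bar>\<beta> - (t * \<beta>1 + (1 - t) * \<beta>2)\<bar> * \<bar>a x\<bar>"
          by (metis abs_ge_self abs_mult)
        also have "\<dots> \<le> E"
          unfolding E_def using aB[OF x] by (intro mult_left_mono) auto
        finally show "\<beta> * a x + \<phi> x
            \<le> t * (\<beta>1 * a x + \<phi>1 x) + (1 - t) * (\<beta>2 * a x + \<phi>2 x) + (c + E)"
          using c[OF x] by (simp add: \<psi>_def algebra_simps)
      qed (use inta int in simp_all)
      also have "\<dots> = t * I1 + (1 - t) * I2 + (c + E)"
        using inta int by (simp add: I1_def I2_def prob_space)
      finally have I: "(\<integral>x. \<beta> * a x + \<phi> x \<partial>\<mu>) \<le> t * I1 + (1 - t) * I2 + (c + E)" .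
      have h1: "ereal I1 + KS_entropy \<mu> shift \<le> ereal (\<phi>1 y + l1)"
        unfolding eig1[OF y, symmetric] effective_operator_def I1_def a_def
        by (rule SUP_upper[OF \<mu>])
      have h2: "ereal I2 + KS_entropy \<mu> shift \<le> ereal (\<phi>2 y + l2)"
        unfolding eig2[OF y, symmetric] effective_operator_def I2_def a_def
        by (rule SUP_upper[OF \<mu>])
      show ?thesis
      proof (cases "KS_entropy \<mu> shift")
        case (real h)
        have "t * (I1 + h) + (1 - t) * (I2 + h) \<le> t * (\<phi>1 y + l1) + (1 - t) * (\<phi>2 y + l2)"
          by (intro add_mono[of "t * _"] mult_left_mono) (use h1 h2 real t in auto)
        then show ?thesis using I real by (simp add: \<psi>_def algebra_simps)
        \<comment> \<open>Entropy \<open>\<infinity>\<close> contradicts the finite bound \<open>h1\<close>; for \<open>-\<infinity>\<close> the claim is trivial.\<close>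
      qed (use h1 in simp_all)
    qed
    then have "effective_operator r M A \<beta> \<phi> y
        \<le> ereal (\<psi> y + (t * l1 + (1 - t) * l2) + c + E)"
      unfolding effective_operator_def a_def by (rule SUP_least)
    then show ?thesis using eig[OF y] by simp
  qed
  \<comment> \<open>Taking the supremum over \<open>y\<close> of \<open>\<phi> y - \<psi> y\<close> makes \<open>c\<close> reappear on the left and cancel.\<close>
  have "c \<le> c + (t * l1 + (1 - t) * l2 + E - l)"
    unfolding c_def using ne
  proof (rule cSUP_least)
    fix y assume "y \<in> ?X"
    from bound[OF this] show "\<phi> y - \<psi> y
        \<le> (SUP x\<in>?X. \<phi> x - \<psi> x) + (t * l1 + (1 - t) * l2 + E - l)"
      unfolding c_def by linarith
  qed
  then show ?thesis by (simp add: E_def)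
qed

section \<open>The limiting slope of a convex function\<close>

text \<open>The difference quotients based at \<open>1\<close> are nondecreasing by convexity and bounded above by
  the growth hypothesis; they converge to their supremum.\<close>

lemma convex_linear_growth_slope_limit:
  fixes f :: "real \<Rightarrow> real"
  assumes conv: "convex_on {0<..} f"
    and growth: "\<And>x. x > 1 \<Longrightarrow> f x \<le> f 1 + (x - 1) * B"
  shows "\<exists>c. ((\<lambda>x. f x / x) \<longlongrightarrow> c) at_top"
proof -
  define s where "s x = (f x - f 1) / (x - 1)" for x
  define c where "c = (SUP x\<in>{1<..}. s x)"
  have mono: "s x \<le> s z" if "1 < x" "x < z" for x z
  proof -
    have flip: "(f 1 - f w) / (1 - w) = s w" for w
      unfolding s_def by (metis minus_diff_eq minus_divide_divide)
    show ?thesis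
      using convex_on_slope_le(1)[OF conv, of 1 z x] that by (simp add: flip)
  qed
  have "s x \<le> B" if "1 < x" for x
    using growth[OF that] that by (simp add: s_def divide_simps mult.commute)
  then have bdd: "bdd_above (s ` {1<..})" by (intro bdd_aboveI2) auto
  have "(s \<longlongrightarrow> c) at_top"
  proof (rule increasing_tendsto)
    show "\<forall>\<^sub>F x in at_top. s x \<le> c"
      using eventually_gt_at_top[of 1]
      by eventually_elim (use bdd in \<open>auto simp: c_def intro!: cSUP_upper\<close>)
  next
    fix u assume "u < c"
    then obtain x where x: "x > 1" "u < s x"
      unfolding c_def using less_cSUP_iff[OF _ bdd] by auto
    show "\<forall>\<^sub>F z in at_top. u < s z"
      using eventually_gt_at_top[of x]
      by eventually_elim (use mono x in fastforce)
  qed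
  moreover have "((\<lambda>x::real. inverse x) \<longlongrightarrow> 0) at_top"
    by (rule tendsto_inverse_0_at_top) (rule filterlim_ident)
  ultimately have "((\<lambda>x. s x * (1 - inverse x) + f 1 * inverse x) \<longlongrightarrow> c * (1 - 0) + f 1 * 0) at_top"
    by (intro tendsto_intros)
  moreover have "\<forall>\<^sub>F x in at_top. s x * (1 - inverse x) + f 1 * inverse x = f x / x"
    using eventually_gt_at_top[of 1]
    by eventually_elim (simp add: s_def field_simps)
  ultimately have "((\<lambda>x. f x / x) \<longlongrightarrow> c * (1 - 0) + f 1 * 0) at_top"
    by (rule Lim_transform_eventually)
  then show ?thesis by blast
qed

section \<open>Existence of the limit\<close>

theorem theorem6:
  fixes r :: nat
    and M :: "nat \<Rightarrow> nat \<Rightarrow> nat"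
    and \<Lambda> :: real
    and A :: "(nat \<Rightarrow> nat) \<times> (nat \<Rightarrow> nat) \<Rightarrow> real"
    and lam :: "real \<Rightarrow> real"
  assumes "transition_matrix r M"
    and "symmetric_matrix r M"
    and "irreducible_matrix r M"
    and "0 < \<Lambda>" and "\<Lambda> < 1"
    and "Lipschitz_wrt (pair_dist \<Lambda>) (natural_extension r M) A"
    and "\<And>\<beta>. \<beta> > 0 \<Longrightarrow> is_effective_constant r M \<Lambda> A \<beta> (lam \<beta>)"
  shows "\<exists>c::real. ((\<lambda>\<beta>. lam \<beta> / \<beta>) \<longlongrightarrow> c) at_top"
proof -
  obtain B where B: "\<And>y x. y \<in> dual_subshift r M \<Longrightarrow> x \<in> subshift r M \<Longrightarrow>
              \<bar>A (y, x) * real (M (y 0) (x 0))\<bar> \<le> B"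
    using zero_extension_bounded[OF assms(4,5,1,6)] by blast
  have mix: "lam \<beta> \<le> t * lam \<beta>1 + (1 - t) * lam \<beta>2 + \<bar>\<beta> - (t * \<beta>1 + (1 - t) * \<beta>2)\<bar> * B"
    if "\<beta> > 0" "\<beta>1 > 0" "\<beta>2 > 0" "0 \<le> t" "t \<le> 1" for \<beta> \<beta>1 \<beta>2 t
    using effective_constant_le_mix[OF assms(1-6) B assms(7) assms(7) assms(7)] that by blast
  show ?thesis
  proof (rule convex_linear_growth_slope_limit)
    show "convex_on {0<..} lam"
    proof (rule convex_onI)
      fix t x y :: real
      assume "0 < t" "t < 1" "x \<in> {0<..}" "y \<in> {0<..}"
      moreover from this have "(1 - t) * x + t * y > 0"
        by (intro add_pos_pos mult_pos_pos) auto
      ultimately show "lam ((1 - t) *\<^sub>R x + t *\<^sub>R y) \<le> (1 - t) * lam x + t * lam y"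
        using mix[of "(1 - t) * x + t * y" x y "1 - t"] by simp
    qed (simp add: convex_real_interval)
    show "lam x \<le> lam 1 + (x - 1) * B" if "x > 1" for x
      using mix[of x 1 1 1] that by simp
  qed
qed

end
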